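(* Let $\mu$ be a probability distribution on subsets of an $n$-element ground set $U$, suppose that every set in $\operatorname{supp}(\mu)$ has size at most $q$, and put $d=\mathbb E_{S\sim\mu}|S|>0$. Let $c>d$ be an integer and set $k=n^{1/c}$. Then there exist $\mathcal D\subseteq\operatorname{supp}(\mu)$, a kernel $K\subseteq U$, an index $j\in\{1,\ldots,c\}$, and $B=\frac{n}{k^j}=n^{1-j/c}$ such that $$\mu(\mathcal D)\ge1-\frac dc,\qquad |K|\le B\le n^{1-1/c}.$$ Moreover, for every $\alpha>1$ for which $p=\frac{\alpha}{k}=\alpha n^{-1/c}\le1$, the conditioned distribution $\mu_{\mathcal D}$ is a $(p,\eta)$-robust daisy with kernel $K$, where $$\eta=\exp\left(-\frac{(\alpha-1)\mu(\mathcal D)B}{2d}\right).$$ In particular, if only the worst-case bound $|S|\le q$ is retained and $c>q$, then $$\mu(\mathcal D)\ge1-\frac qc,\qquad \eta\le\exp\left(-\frac{(\alpha-1)(1-q/c)}{2q}|K|\right).$$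
   Context: $\mu_{\mathcal D}$ denotes $\mu$ conditioned on $\mathcal D$. Let $\nu$ be a probability distribution on a finite family of subsets of a ground set $U$, let $p\in(0,1]$, $\eta\in(0,1)$, and let $K\subseteq U$. Then $\nu$ is a $(p,\eta)$-robust daisy with kernel $K$ if, for every $\mathcal A\subseteq\operatorname{supp}(\nu)$, $$\mathbb P_{W}\bigl[\exists S\in\mathcal A:\ S\setminus K\subseteq W\bigr]\ge1-\eta^{\nu(\mathcal A)},$$ where $W\subseteq U$ is the random set containing each element of $U$ independently with probability $p$. *)

theory Defs
  imports "HOL-Probability.Probability"
begin

text \<open>The random subset of the finite set \<open>U\<close> that contains each element of \<open>U\<close>
  independently with probability \<open>p\<close>.\<close>

definition random_subset :: "'a set \<Rightarrow> real \<Rightarrow> 'a set pmf" where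
  "random_subset U p =
     map_pmf (\<lambda>f. {x \<in> U. f x}) (Pi_pmf U False (\<lambda>_. bernoulli_pmf p))"

text \<open>Ground sets are finite here, as \<^const>\<open>Pi_pmf\<close> requires; so the support of
  \<open>\<nu>\<close> is automatically a finite family.  The ranges of \<open>p\<close> and \<open>\<eta>\<close> and
  \<open>K \<subseteq> U\<close> are part of the predicate, so that a theorem concluding it also asserts them.\<close>

definition robust_daisy ::
    "'a set \<Rightarrow> real \<Rightarrow> real \<Rightarrow> 'a set pmf \<Rightarrow> 'a set \<Rightarrow> bool" where
  "robust_daisy U p \<eta> \<nu> K \<longleftrightarrow>
     finite U \<and> set_pmf \<nu> \<subseteq> Pow U \<and> 0 < p \<and> p \<le> 1 \<and> 0 < \<eta> \<and> \<eta> < 1 \<and> K \<subseteq> U \<and>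
     (\<forall>\<A> \<subseteq> set_pmf \<nu>.
        measure_pmf.prob (random_subset U p) {W. \<exists>S\<in>\<A>. S - K \<subseteq> W}
          \<ge> 1 - \<eta> powr (measure_pmf.prob \<nu> \<A>))"

end

theory Submission
  imports Defs
begin

text \<open>Let \<open>g x\<close> be the probability that \<open>x \<in> S\<close>, so that the degrees \<open>g x\<close> sum to \<open>d\<close>, and
  let \<open>K i\<close> consist of the points of degree at least \<open>d k\<^sup>i / n\<close> (with \<open>K 0 = U\<close>); by Markov's
  inequality it has at most \<open>n / k\<^sup>i\<close> points. For fixed \<open>S\<close> the walk \<open>i \<mapsto> i - card (S - K i)\<close> starts
  at 0, goes up by at most 1 per step, and ends at height at least \<open>c - card S\<close>, so it has at least
  \<open>c - card S\<close> strict records. Averaging over \<open>S\<close> gives a level \<open>j\<close> that is a record with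
  probability at least \<open>1 - d / c\<close>; these \<open>S\<close> form the family, and \<open>K j\<close> is the kernel.

  If \<open>j\<close> is a record for \<open>S\<close>, the point of the petal \<open>S - K j\<close> with the \<open>r\<close>-th largest degree has
  degree at most \<open>d k\<^sup>j\<^sup>-\<^sup>r / n\<close>. Two petals whose least popular common point has rank \<open>r\<close> share at most
  \<open>r\<close> points, so the normalised pair correlations of the events \<open>S - K j \<subseteq> W\<close> are bounded by the
  geometric series over \<open>r\<close> of \<open>\<alpha>\<^sup>-\<^sup>r\<close>, and Janson's inequality concludes.\<close>

subsection \<open>Janson's inequality\<close>

lemma random_subset_insert:
  assumes "finite U" "x \<notin> U"
  shows "random_subset (insert x U) p =
    bind_pmf (bernoulli_pmf p) (\<lambda>b. map_pmf (\<lambda>W. if b then insert x W else W) (random_subset U p))"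
proof -
  have *: "map_pmf (\<lambda>f. {y \<in> insert x U. (f(x := b)) y}) (Pi_pmf U False (\<lambda>_. bernoulli_pmf p))
     = map_pmf (\<lambda>f. if b then insert x {y \<in> U. f y} else {y \<in> U. f y})
         (Pi_pmf U False (\<lambda>_. bernoulli_pmf p))" for b
    using assms(2) by (intro map_pmf_cong) auto
  have "random_subset (insert x U) p = bind_pmf (bernoulli_pmf p)
      (\<lambda>b. map_pmf (\<lambda>f. {y \<in> insert x U. (f(x := b)) y}) (Pi_pmf U False (\<lambda>_. bernoulli_pmf p)))"
    unfolding random_subset_def Pi_pmf_insert'[OF assms]
    by (simp only: map_pmf_def bind_assoc_pmf bind_return_pmf)
  then show ?thesis
    by (simp only: * random_subset_def pmf.map_comp o_def)
qed

lemma set_pmf_random_subset: "set_pmf (random_subset U p) \<subseteq> Pow U"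
  by (auto simp: random_subset_def)

lemma finite_set_pmf_random_subset: "finite U \<Longrightarrow> finite (set_pmf (random_subset U p))"
  by (rule finite_subset[OF set_pmf_random_subset]) simp

lemma integrable_random_subset [simp]:
  "finite U \<Longrightarrow> integrable (measure_pmf (random_subset U p)) (f :: _ \<Rightarrow> real)"
  by (simp add: integrable_measure_pmf_finite finite_set_pmf_random_subset)

lemma expectation_random_subset_insert:
  fixes f :: "'a set \<Rightarrow> real"
  assumes "finite U" "x \<notin> U" "0 \<le> p" "p \<le> 1"
  shows "measure_pmf.expectation (random_subset (insert x U) p) f =
    p * measure_pmf.expectation (random_subset U p) (\<lambda>W. f (insert x W)) +
    (1 - p) * measure_pmf.expectation (random_subset U p) f"
proof -
  let ?g = "\<lambda>b. map_pmf (\<lambda>W. if b then insert x W else W) (random_subset U p)"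
  have "measure_pmf.expectation (random_subset (insert x U) p) f =
      (\<Sum>b\<in>UNIV. pmf (bernoulli_pmf p) b *\<^sub>R measure_pmf.expectation (?g b) f)"
    unfolding random_subset_insert[OF assms(1,2)] using assms(1)
    by (intro pmf_expectation_bind) (simp_all add: finite_set_pmf_random_subset)
  also have "\<dots> = p * measure_pmf.expectation (?g True) f + (1 - p) * measure_pmf.expectation (?g False) f"
    using assms(3,4) by (simp add: UNIV_bool)
  finally show ?thesis
    by simp
qed

text \<open>Induction on \<open>U\<close>. Splitting on one point, the product of the averages falls
  short of the average of the products by the two-point covariance
  \<open>p * (1 - p) * ((F0 - F1) * (G0 - G1))\<close>, which is nonnegative because both functions
  decrease when the point is added.\<close>

lemma random_subset_harris:
  fixes f g :: "'a set \<Rightarrow> real"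
  assumes "finite U" "0 \<le> p" "p \<le> 1" "antimono f" "antimono g"
  shows "measure_pmf.expectation (random_subset U p) f * measure_pmf.expectation (random_subset U p) g
    \<le> measure_pmf.expectation (random_subset U p) (\<lambda>W. f W * g W)"
  using assms(1,4,5)
proof (induction U arbitrary: f g)
  case empty
  then show ?case by (simp add: random_subset_def)
next
  case (insert x U)
  let ?E = "measure_pmf.expectation (random_subset U p)"
  define F0 F1 G0 G1 where "F0 = ?E f" and "F1 = ?E (\<lambda>W. f (insert x W))"
    and "G0 = ?E g" and "G1 = ?E (\<lambda>W. g (insert x W))"
  note defs = F0_def F1_def G0_def G1_def
  have anti: "antimono (\<lambda>W. h (insert x W))" if "antimono h" for h :: "'a set \<Rightarrow> real"
    by (intro antimonoI antimonoD[OF that]) auto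
  have le: "F1 \<le> F0" "G1 \<le> G0"
    unfolding defs using insert by (auto intro!: integral_mono antimonoD[OF insert.prems(1)] antimonoD[OF insert.prems(2)])
  have IH: "F0 * G0 \<le> ?E (\<lambda>W. f W * g W)"
    "F1 * G1 \<le> ?E (\<lambda>W. f (insert x W) * g (insert x W))"
    unfolding defs using insert.IH anti insert.prems by auto
  have "(p * F1 + (1 - p) * F0) * (p * G1 + (1 - p) * G0) =
    p * (F1 * G1) + (1 - p) * (F0 * G0) - p * (1 - p) * ((F0 - F1) * (G0 - G1))"
    by (simp add: algebra_simps)
  also have "\<dots> \<le> p * (F1 * G1) + (1 - p) * (F0 * G0)"
    using le assms(2,3) by simp
  also have "\<dots> \<le> p * ?E (\<lambda>W. f (insert x W) * g (insert x W)) + (1 - p) * ?E (\<lambda>W. f W * g W)"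
    using IH assms(2,3) by (intro add_mono mult_left_mono) auto
  finally show ?case
    using insert.hyps assms(2,3) by (simp add: expectation_random_subset_insert defs)
qed

lemma random_subset_condition_elem:
  fixes f :: "'a set \<Rightarrow> real"
  assumes "finite U" "0 \<le> p" "p \<le> 1" "x \<in> U"
  shows "measure_pmf.expectation (random_subset U p) (\<lambda>W. of_bool (x \<in> W) * f W) =
    p * measure_pmf.expectation (random_subset U p) (\<lambda>W. f (insert x W))"
proof -
  define V where "V = U - {x}"
  have V: "U = insert x V" "finite V" "x \<notin> V"
    using assms by (auto simp: V_def)
  have "measure_pmf.expectation (random_subset V p) (\<lambda>W. of_bool (x \<in> W) * f W)
      = measure_pmf.expectation (random_subset V p) (\<lambda>W. 0)"
    using set_pmf_random_subset[of V p] V(3) by (intro integral_cong_AE) (auto simp: AE_measure_pmf_iff)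
  then show ?thesis
    using V assms by (simp add: expectation_random_subset_insert algebra_simps)
qed

text \<open>By independence, conditioning on \<open>S \<subseteq> W\<close> amounts to replacing
  \<open>W\<close> by \<open>W \<union> S\<close>. The unnormalised form also covers events of
  probability 0.\<close>

lemma random_subset_condition:
  fixes f :: "'a set \<Rightarrow> real"
  assumes "finite U" "0 \<le> p" "p \<le> 1" "S \<subseteq> U"
  shows "measure_pmf.expectation (random_subset U p) (\<lambda>W. of_bool (S \<subseteq> W) * f W) =
    p ^ card S * measure_pmf.expectation (random_subset U p) (\<lambda>W. f (W \<union> S))"
  using finite_subset[OF assms(4,1)] assms(4)
proof (induction S arbitrary: f)
  case empty
  then show ?case by simp
next
  case (insert x S)
  let ?E = "measure_pmf.expectation (random_subset U p)"
  have "?E (\<lambda>W. of_bool (insert x S \<subseteq> W) * f W) = ?E (\<lambda>W. of_bool (S \<subseteq> W) * (of_bool (x \<in> W) * f W))"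
    by (intro Bochner_Integration.integral_cong) auto
  also have "\<dots> = p ^ card S * ?E (\<lambda>W. of_bool (x \<in> W) * f (W \<union> S))"
    using insert by (subst insert.IH) auto
  also have "\<dots> = p ^ card (insert x S) * ?E (\<lambda>W. f (W \<union> insert x S))"
    using insert assms by (subst random_subset_condition_elem) auto
  finally show ?case .
qed

lemma random_subset_prob_superset:
  assumes "finite U" "0 \<le> p" "p \<le> 1" "S \<subseteq> U"
  shows "measure_pmf.expectation (random_subset U p) (\<lambda>W. of_bool (S \<subseteq> W)) = p ^ card S"
  using random_subset_condition[OF assms, of "\<lambda>_. 1"] by simp

text \<open>The weights \<open>w\<close> are needed because the sets \<open>P i\<close> will be weighted by \<open>\<mu>\<close>. With \<open>X\<close> the
  weighted number of \<open>P i\<close> contained in \<open>W\<close>, Harris' inequality gives a differential inequality for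
  \<open>s \<mapsto> E (exp (- s X))\<close>; it is integrated up to the optimal \<open>s = M / \<Delta>\<close>.\<close>

lemma random_subset_janson:
  fixes w :: "'i \<Rightarrow> real" and P :: "'i \<Rightarrow> 'a set"
  assumes U: "finite U" and p: "0 \<le> p" "p \<le> 1"
    and I: "finite I" "\<And>i. i \<in> I \<Longrightarrow> P i \<subseteq> U" and w: "\<And>i. i \<in> I \<Longrightarrow> 0 \<le> w i"
    and M: "M = (\<Sum>i\<in>I. w i * p ^ card (P i))"
    and \<Delta>: "(\<Sum>i\<in>I. \<Sum>j | j \<in> I \<and> P i \<inter> P j \<noteq> {}. w i * w j * p ^ card (P i \<union> P j)) \<le> \<Delta>" "0 < \<Delta>"
  shows "measure_pmf.prob (random_subset U p) {W. \<forall>i\<in>I. \<not> P i \<subseteq> W} \<le> exp (- (M\<^sup>2 / (2 * \<Delta>)))"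
proof -
  let ?R = "random_subset U p"
  let ?E = "measure_pmf.expectation ?R"
  define X where "X = (\<lambda>J W. \<Sum>i\<in>J. w i * of_bool (P i \<subseteq> W))"
  define N where "N = (\<lambda>i. {j \<in> I. P i \<inter> P j \<noteq> {}})"
  define \<psi> where "\<psi> = (\<lambda>s. ?E (\<lambda>W. exp (- s * X I W)))"
  have N: "N i \<subseteq> I" "finite (N i)" for i
    using I by (auto simp: N_def)
  have Xmono: "X J V \<le> X J W" if "J \<subseteq> I" "V \<subseteq> W" for J V W
    unfolding X_def using that w by (intro sum_mono mult_left_mono) auto
  have X0: "0 \<le> X J W" if "J \<subseteq> I" for J W
    unfolding X_def using that w by (intro sum_nonneg) auto
  have \<psi>pos: "\<psi> s \<ge> 0" for s
    unfolding \<psi>_def by (intro integral_nonneg_AE) auto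
  have M0: "0 \<le> M"
    unfolding M using w p by (intro sum_nonneg) auto
  have EN: "?E (\<lambda>W. of_bool (P i \<subseteq> W) * X (N i) W) = (\<Sum>j\<in>N i. w j * p ^ card (P i \<union> P j))"
    if i: "i \<in> I" for i
  proof -
    have "?E (\<lambda>W. of_bool (P i \<subseteq> W) * X (N i) W) = ?E (\<lambda>W. \<Sum>j\<in>N i. w j * of_bool (P i \<union> P j \<subseteq> W))"
      unfolding X_def sum_distrib_left by (intro Bochner_Integration.integral_cong sum.cong) auto
    also have "\<dots> = (\<Sum>j\<in>N i. w j * ?E (\<lambda>W. of_bool (P i \<union> P j \<subseteq> W)))"
      using U by (subst Bochner_Integration.integral_sum) (auto simp: integrable_random_subset)
    also have "\<dots> = (\<Sum>j\<in>N i. w j * p ^ card (P i \<union> P j))"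
    proof (intro sum.cong refl)
      fix j assume "j \<in> N i"
      then have "P i \<union> P j \<subseteq> U"
        using I(2)[OF i] I(2)[of j] by (auto simp: N_def)
      then show "w j * ?E (\<lambda>W. of_bool (P i \<union> P j \<subseteq> W)) = w j * p ^ card (P i \<union> P j)"
        by (simp only: random_subset_prob_superset[OF U p])
    qed
    finally show ?thesis .
  qed
  \<comment> \<open>After conditioning on \<open>P i \<subseteq> W\<close>, the sum
    \<open>X I\<close> splits into the neighbours \<open>N i\<close> and the rest. Harris'
    inequality separates the two exponentials; the first is bounded below by
    \<open>1 - x \<le> exp (- x)\<close>, the second by \<open>\<psi> s\<close>, as
    \<open>X (N i)\<close> is nonnegative.\<close>
  have key: "(p ^ card (P i) - s * (\<Sum>j\<in>N i. w j * p ^ card (P i \<union> P j))) * \<psi> s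
      \<le> ?E (\<lambda>W. of_bool (P i \<subseteq> W) * exp (- s * X I W))" if i: "i \<in> I" and s: "0 \<le> s" for i s
  proof -
    have split: "X I W = X (N i) W + X (I - N i) W" for W
      unfolding X_def using sum.subset_diff[OF N(1) I(1)] by (simp only: add.commute)
    \<comment> \<open>Outside \<open>N i\<close> every \<open>P j\<close> is disjoint from
      \<open>P i\<close>. This includes the case of an empty \<open>P i\<close>, where
      \<open>i\<close> itself is not in \<open>N i\<close>.\<close>
    have indep: "X (I - N i) (W \<union> P i) = X (I - N i) W" for W
      unfolding X_def using i by (intro sum.cong) (auto simp: N_def)
    have "(1 - s * ?E (\<lambda>W. X (N i) (W \<union> P i))) * \<psi> s
        = ?E (\<lambda>W. 1 - s * X (N i) (W \<union> P i)) * \<psi> s"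
      using U by simp
    also have "\<dots> \<le> ?E (\<lambda>W. exp (- s * X (N i) (W \<union> P i))) * ?E (\<lambda>W. exp (- s * X (I - N i) W))"
    proof (rule mult_mono)
      show "?E (\<lambda>W. 1 - s * X (N i) (W \<union> P i)) \<le> ?E (\<lambda>W. exp (- s * X (N i) (W \<union> P i)))"
        using U by (intro integral_mono) (auto intro: order_trans[OF _ exp_ge_add_one_self])
      show "\<psi> s \<le> ?E (\<lambda>W. exp (- s * X (I - N i) W))"
        unfolding \<psi>_def using U s X0[of "N i"] N(1)
        by (intro integral_mono) (auto simp: split intro!: mult_left_mono)
    qed (use \<psi>pos in \<open>auto intro!: integral_nonneg_AE\<close>)
    also have "\<dots> \<le> ?E (\<lambda>W. exp (- s * X (N i) (W \<union> P i)) * exp (- s * X (I - N i) W))"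
      using U p s N(1) by (intro random_subset_harris antimonoI) (auto intro!: mult_left_mono Xmono)
    also have "\<dots> = ?E (\<lambda>W. exp (- s * X I (W \<union> P i)))"
      by (intro Bochner_Integration.integral_cong) (auto simp: split indep exp_add[symmetric] algebra_simps)
    finally have "p ^ card (P i) * ((1 - s * ?E (\<lambda>W. X (N i) (W \<union> P i))) * \<psi> s)
       \<le> p ^ card (P i) * ?E (\<lambda>W. exp (- s * X I (W \<union> P i)))"
      using p by (intro mult_left_mono) auto
    also have "\<dots> = ?E (\<lambda>W. of_bool (P i \<subseteq> W) * exp (- s * X I W))"
      using random_subset_condition[OF U p I(2)[OF i]] by simp
    finally show ?thesis
      using random_subset_condition[OF U p I(2)[OF i], of "X (N i)"] EN[OF i]
      by (simp add: algebra_simps)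
  qed
  have deriv: "(\<psi> has_real_derivative - ?E (\<lambda>W. X I W * exp (- s * X I W))) (at s)" for s
  proof -
    have sum: "?E f = (\<Sum>W\<in>Pow U. f W * pmf ?R W)" for f
      using U set_pmf_random_subset[of U p] by (intro integral_measure_pmf_real) auto
    show ?thesis
      unfolding \<psi>_def sum by (auto intro!: derivative_eq_intros simp: sum_negf[symmetric] algebra_simps)
  qed
  \<comment> \<open>Weighted sum of \<open>key\<close> over \<open>i\<close>. By
    \<open>deriv\<close> the right-hand side is minus the derivative of \<open>\<psi>\<close>, so
    \<open>\<psi>\<close> decays at least at the relative rate
    \<open>M - s * \<Delta>\<close>.\<close>
  have drift: "(M - s * \<Delta>) * \<psi> s \<le> ?E (\<lambda>W. X I W * exp (- s * X I W))" if s: "0 \<le> s" for s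
  proof -
    have "M - s * \<Delta> \<le> M - s * (\<Sum>i\<in>I. \<Sum>j\<in>N i. w i * w j * p ^ card (P i \<union> P j))"
      using \<Delta>(1) s by (simp add: N_def mult_left_mono)
    also have "\<dots> = (\<Sum>i\<in>I. w i * (p ^ card (P i) - s * (\<Sum>j\<in>N i. w j * p ^ card (P i \<union> P j))))"
      by (simp add: M sum_subtractf sum_distrib_left algebra_simps)
    finally have "(M - s * \<Delta>) * \<psi> s
       \<le> (\<Sum>i\<in>I. w i * (p ^ card (P i) - s * (\<Sum>j\<in>N i. w j * p ^ card (P i \<union> P j)))) * \<psi> s"
      using \<psi>pos by (intro mult_right_mono)
    also have "\<dots> \<le> (\<Sum>i\<in>I. w i * ?E (\<lambda>W. of_bool (P i \<subseteq> W) * exp (- s * X I W)))"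
      unfolding sum_distrib_right mult.assoc using key s w by (intro sum_mono mult_left_mono) auto
    also have "\<dots> = ?E (\<lambda>W. X I W * exp (- s * X I W))"
      using U by (simp add: X_def sum_distrib_right mult.assoc)
    finally show ?thesis .
  qed
  \<comment> \<open>The exponential is the integrating factor for the rate
    \<open>M - s * \<Delta>\<close>, so \<open>g\<close> is nonincreasing for nonnegative
    arguments.\<close>
  define g where "g = (\<lambda>s. \<psi> s * exp (s * M - s\<^sup>2 * \<Delta> / 2))"
  define s where "s = M / \<Delta>"
  have s0: "0 \<le> s"
    using M0 \<Delta>(2) by (simp add: s_def)
  have "g s \<le> g 0"
  proof (rule DERIV_nonpos_imp_nonincreasing[OF s0])
    fix t assume t: "0 \<le> t" "t \<le> s"
    have "(g has_real_derivative
        ((M - t * \<Delta>) * \<psi> t - ?E (\<lambda>W. X I W * exp (- t * X I W))) * exp (t * M - t\<^sup>2 * \<Delta> / 2)) (at t)"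
      unfolding g_def by (auto intro!: derivative_eq_intros deriv simp: algebra_simps power2_eq_square)
    then show "\<exists>y. (g has_real_derivative y) (at t) \<and> y \<le> 0"
      using drift[OF t(1)] by (auto intro!: exI mult_nonpos_nonneg)
  qed
  also have "g 0 = 1"
    by (simp add: g_def \<psi>_def)
  also have "g s = \<psi> s * exp (M\<^sup>2 / (2 * \<Delta>))"
    using \<Delta>(2) by (simp add: g_def s_def power2_eq_square field_simps)
  finally have "\<psi> s \<le> exp (- (M\<^sup>2 / (2 * \<Delta>)))"
    by (simp add: exp_minus field_simps)
  moreover have "measure_pmf.prob ?R {W. \<forall>i\<in>I. \<not> P i \<subseteq> W} \<le> \<psi> s"
  proof -
    have "measure_pmf.prob ?R {W. \<forall>i\<in>I. \<not> P i \<subseteq> W} = ?E (indicator {W. \<forall>i\<in>I. \<not> P i \<subseteq> W})"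
      by simp
    \<comment> \<open>On the event \<open>X I W\<close> vanishes, so the exponential equals 1
      there.\<close>
    also have "\<dots> \<le> \<psi> s"
      unfolding \<psi>_def using U by (intro integral_mono) (auto simp: indicator_def X_def)
    finally show ?thesis .
  qed
  ultimately show ?thesis by linarith
qed

subsection \<open>Record levels\<close>

text \<open>As \<open>N\<close> is monotone, the walk \<open>i - N i\<close> rises by at most 1 per
  step, so its running maximum grows by at most 1 at each record and not at all elsewhere.\<close>

lemma card_strict_records:
  fixes N :: "nat \<Rightarrow> nat"
  assumes "N 0 = 0" "mono N"
  shows "c \<le> N c + card {j \<in> {1..c}. \<forall>i<j. N j + i < N i + j}"
proof -
  define R where "R = (\<lambda>c. {j \<in> {1..c}. \<forall>i<j. N j + i < N i + j})"
  have fin: "finite (R m)" for m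
    by (simp add: R_def)
  \<comment> \<open>The induction needs all \<open>i \<le> c\<close>: a level that is not a record
    is compared with an earlier level that is at least as high.\<close>
  have "i \<le> N i + card (R c)" if "i \<le> c" for i
    using that
  proof (induction c arbitrary: i)
    case 0
    then show ?case by simp
  next
    case (Suc c)
    have le: "card (R c) \<le> card (R (Suc c))"
      by (intro card_mono fin) (auto simp: R_def)
    show ?case
    proof (cases "i \<le> c")
      case True
      then show ?thesis
        using Suc.IH[of i] le by linarith
    next
      case False
      with Suc.prems have i: "i = Suc c" by simp
      show ?thesis
      proof (cases "i \<in> R i")
        case True
        then have "R (Suc c) = insert (Suc c) (R c)"
          by (auto simp: R_def i le_Suc_eq)
        moreover have "Suc c \<notin> R c"
          by (simp add: R_def)
        ultimately have "card (R (Suc c)) = Suc (card (R c))"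
          using fin by simp
        then show ?thesis
          using Suc.IH[of c] monoD[OF assms(2), of c "Suc c"] i by simp
      next
        case False
        then obtain l where "l < i" "N l + i \<le> N i + l"
          by (auto simp: R_def i not_less)
        then show ?thesis
          using Suc.IH[of l] le i by simp
      qed
    qed
  qed
  from this[of c] show ?thesis
    by (simp add: R_def)
qed

text \<open>With ties all points of equal value receive the largest rank, which only decreases the powers.\<close>

lemma sum_power_rank_le:
  fixes g :: "'a \<Rightarrow> real" and \<beta> :: real
  assumes "finite P" "0 \<le> \<beta>" "\<beta> \<le> 1"
  shows "(\<Sum>x\<in>P. \<beta> ^ card {y \<in> P. g x \<le> g y}) * (1 - \<beta>) \<le> \<beta> - \<beta> ^ Suc (card P)"
  using assms(1)
\<comment> \<open>With the sign reversed, points arrive in order of decreasing \<open>g\<close>. The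
  new point is then outranked or tied by all others and contributes the next power of
  \<open>\<beta>\<close>, while the ranks of the old points can only grow.\<close>
proof (induction P rule: finite_ranking_induct[where f = "\<lambda>x. - g x"])
  case empty
  then show ?case by simp
next
  case (insert x S)
  show ?case
  proof (cases "x \<in> S")
    case True
    then show ?thesis
      using insert by (simp add: insert_absorb)
  next
    case False
    have "{y \<in> insert x S. g x \<le> g y} = insert x S"
      using insert by auto
    moreover have "(\<Sum>z\<in>S. \<beta> ^ card {y \<in> insert x S. g z \<le> g y}) \<le> (\<Sum>z\<in>S. \<beta> ^ card {y \<in> S. g z \<le> g y})"
      using insert(1) assms by (intro sum_mono power_decreasing card_mono) auto
    ultimately have "(\<Sum>z\<in>insert x S. \<beta> ^ card {y \<in> insert x S. g z \<le> g y})
        \<le> \<beta> ^ Suc (card S) + (\<Sum>z\<in>S. \<beta> ^ card {y \<in> S. g z \<le> g y})"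
      using insert(1) False by simp
    then have "(\<Sum>z\<in>insert x S. \<beta> ^ card {y \<in> insert x S. g z \<le> g y}) * (1 - \<beta>)
        \<le> (\<beta> ^ Suc (card S) + (\<Sum>z\<in>S. \<beta> ^ card {y \<in> S. g z \<le> g y})) * (1 - \<beta>)"
      using assms by (intro mult_right_mono) auto
    then show ?thesis
      using insert(1,3) False by (simp add: algebra_simps)
  qed
qed

text \<open>The term of the common point with least \<open>g\<close> suffices, since its rank counts
  all of \<open>P \<inter> T\<close>. Summing over all \<open>x\<close> removes the dependence of
  this point on \<open>T\<close>, so that \<open>T\<close> can be averaged out.\<close>

lemma power_card_inter_le_sum_rank:
  fixes g :: "'a \<Rightarrow> real" and b :: real
  assumes "finite P" "1 \<le> b" "P \<inter> T \<noteq> {}"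
  shows "b ^ card (P \<inter> T) \<le> (\<Sum>x\<in>P. of_bool (x \<in> T) * b ^ card {y \<in> P. g x \<le> g y})"
proof -
  have "Min (g ` (P \<inter> T)) \<in> g ` (P \<inter> T)"
    using assms by (intro Min_in) auto
  then obtain x where x: "x \<in> P" "x \<in> T" "g x = Min (g ` (P \<inter> T))"
    by auto
  then have "P \<inter> T \<subseteq> {y \<in> P. g x \<le> g y}"
    using assms(1) by auto
  then have "b ^ card (P \<inter> T) \<le> of_bool (x \<in> T) * b ^ card {y \<in> P. g x \<le> g y}"
    using assms(1,2) x by (simp add: power_increasing card_mono)
  also have "\<dots> \<le> (\<Sum>x\<in>P. of_bool (x \<in> T) * b ^ card {y \<in> P. g x \<le> g y})"
    using assms x by (intro member_le_sum) auto
  finally show ?thesis .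
qed

text \<open>Level 0 is all of \<open>U\<close>, not the set of points of value at least \<open>t\<close>: points of very small
  degree then count towards level 1, and the walk \<open>i \<mapsto> i - card (S - K i)\<close> starts at 0.\<close>

definition heavy :: "'a set \<Rightarrow> ('a \<Rightarrow> real) \<Rightarrow> real \<Rightarrow> real \<Rightarrow> nat \<Rightarrow> 'a set" where
  "heavy U g t k i = (if i = 0 then U else {x \<in> U. t * k ^ i \<le> g x})"

text \<open>Level \<open>j\<close> is a strict record of \<open>i \<mapsto> i - card (S - K i)\<close>, with the subtractions cleared.\<close>

definition ladder :: "(nat \<Rightarrow> 'a set) \<Rightarrow> nat \<Rightarrow> 'a set \<Rightarrow> bool" where
  "ladder K j S \<longleftrightarrow> (\<forall>i<j. card (S - K j) + i < card (S - K i) + j)"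

lemma heavy_antimono:
  assumes "0 \<le> t" "1 \<le> k" "i \<le> j"
  shows "heavy U g t k j \<subseteq> heavy U g t k i"
proof -
  have "t * k ^ i \<le> t * k ^ j"
    using assms by (intro mult_left_mono power_increasing) auto
  with assms(3) show ?thesis
    by (auto simp: heavy_def)
qed

text \<open>Let \<open>i = Suc l\<close> be the first level that \<open>x\<close> leaves. Points at
  least as popular as \<open>x\<close> still lie in level \<open>l\<close>, so they are among those
  of \<open>S\<close> lost between levels \<open>l\<close> and \<open>j\<close>. The record property
  makes these fewer than \<open>j - l\<close>, and \<open>x\<close> has degree at most
  \<open>t * k ^ i\<close>.\<close>

lemma ladder_rank_bound:
  fixes g :: "'a \<Rightarrow> real"
  assumes S: "finite S" "S \<subseteq> U" and tk: "0 \<le> t" "1 \<le> k"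
    and lad: "ladder (heavy U g t k) j S" and x: "x \<in> S - heavy U g t k j"
  shows "g x * k ^ card {y \<in> S - heavy U g t k j. g x \<le> g y} \<le> t * k ^ j"
proof -
  let ?K = "heavy U g t k"
  let ?R = "{y \<in> S - ?K j. g x \<le> g y}"
  define i where "i = (LEAST i. x \<notin> ?K i)"
  have i: "x \<notin> ?K i" "i \<le> j"
    unfolding i_def using x LeastI[of "\<lambda>i. x \<notin> ?K i" j] Least_le[of "\<lambda>i. x \<notin> ?K i" j] by blast+
  have "i \<noteq> 0"
  proof
    assume "i = 0"
    with i(1) x S(2) show False by (auto simp: heavy_def)
  qed
  then obtain l where l: "i = Suc l"
    using not0_implies_Suc by blast
  have "x \<in> ?K l"
    using not_less_Least[of l "\<lambda>i. x \<notin> ?K i"] l by (auto simp: i_def)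
  then have "?R \<inter> (S - ?K l) = {}"
    using S(2) by (auto simp: heavy_def split: if_splits)
  moreover have "?R \<union> (S - ?K l) \<subseteq> S - ?K j"
    using heavy_antimono[OF tk, of l j U g] i l by auto
  ultimately have "card ?R + card (S - ?K l) \<le> card (S - ?K j)"
    using S(1) by (metis (no_types, lifting) card_Un_disjoint card_mono finite_Diff finite_Un finite_subset)
  moreover have "card (S - ?K j) + l < card (S - ?K l) + j"
    using lad i l by (auto simp: ladder_def)
  ultimately have le: "i + card ?R \<le> j"
    using l by linarith
  have "g x \<le> t * k ^ i"
    using i(1) \<open>i \<noteq> 0\<close> x S(2) by (auto simp: heavy_def)
  then have "g x * k ^ card ?R \<le> t * k ^ i * k ^ card ?R"
    using tk by (intro mult_right_mono) auto
  also have "\<dots> = t * k ^ (i + card ?R)"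
    by (simp add: power_add)
  also have "\<dots> \<le> t * k ^ j"
    using tk le by (intro mult_left_mono power_increasing) auto
  finally show ?thesis .
qed

section \<open>Pair correlations of the petals and the resulting spread\<close>

lemma sum_pmf_of_bool:
  assumes "finite A"
  shows "(\<Sum>S\<in>A. pmf \<mu> S * of_bool (Q S)) = measure_pmf.prob \<mu> {S \<in> A. Q S}"
proof -
  have "(\<Sum>S\<in>A. pmf \<mu> S * of_bool (Q S)) = (\<Sum>S\<in>A. if Q S then pmf \<mu> S else 0)"
    by (intro sum.cong) auto
  also have "\<dots> = (\<Sum>S | S \<in> A \<and> Q S. pmf \<mu> S)"
    by (rule sum.inter_filter[symmetric, OF assms])
  also have "\<dots> = measure_pmf.prob \<mu> {S \<in> A. Q S}"
    using assms by (intro measure_measure_pmf_finite[symmetric]) simp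
  finally show ?thesis .
qed

text \<open>With \<open>p = \<alpha> / k\<close>, the power of \<open>k / \<alpha>\<close> is the
  probability that both petals lie in \<open>W\<close> divided by the product of the separate
  probabilities. Averaging the rank bound over \<open>T\<close> produces the degrees
  \<open>g x\<close>; \<open>ladder_rank_bound\<close> absorbs \<open>k ^ r x\<close>, and the
  remaining powers of \<open>1 / \<alpha>\<close> sum to at most
  \<open>1 / (\<alpha> - 1)\<close>.\<close>

lemma ladder_correlation_bound:
  fixes \<mu> :: "'a set pmf" and U :: "'a set" and t k \<alpha> :: real and j :: nat
  defines "g \<equiv> \<lambda>x. measure_pmf.prob \<mu> {S. x \<in> S}"
  defines "P \<equiv> \<lambda>S. S - heavy U g t k j"
  assumes U: "finite U" and A: "finite A" "S \<in> A" "S \<subseteq> U" and tk: "0 \<le> t" "1 \<le> k"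
    and lad: "ladder (heavy U g t k) j S" and \<alpha>: "1 < \<alpha>" "\<alpha> \<le> k"
  shows "(\<Sum>T | T \<in> A \<and> P S \<inter> P T \<noteq> {}. pmf \<mu> T * (k / \<alpha>) ^ card (P S \<inter> P T)) \<le> t * k ^ j / (\<alpha> - 1)"
proof -
  let ?b = "k / \<alpha>"
  define r where "r = (\<lambda>x. card {y \<in> P S. g x \<le> g y})"
  have fin: "finite (P S)" "finite S"
    using U A by (auto simp: P_def intro: finite_subset)
  have b: "1 \<le> ?b"
    using \<alpha> by simp
  \<comment> \<open>All petals omit the same kernel, so only \<open>x \<in> T\<close> has to be
    averaged over \<open>T\<close>.\<close>
  have Int: "P S \<inter> P T = P S \<inter> T" for T
    by (auto simp: P_def)
  have "(\<Sum>T | T \<in> A \<and> P S \<inter> P T \<noteq> {}. pmf \<mu> T * ?b ^ card (P S \<inter> P T))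
      \<le> (\<Sum>T | T \<in> A \<and> P S \<inter> P T \<noteq> {}. pmf \<mu> T * (\<Sum>x\<in>P S. of_bool (x \<in> T) * ?b ^ r x))"
    unfolding Int r_def using fin b
    by (intro sum_mono mult_left_mono power_card_inter_le_sum_rank) auto
  also have "\<dots> \<le> (\<Sum>T\<in>A. pmf \<mu> T * (\<Sum>x\<in>P S. of_bool (x \<in> T) * ?b ^ r x))"
    using A b by (intro sum_mono2 mult_nonneg_nonneg sum_nonneg) auto
  also have "\<dots> = (\<Sum>x\<in>P S. (\<Sum>T\<in>A. pmf \<mu> T * of_bool (x \<in> T)) * ?b ^ r x)"
    by (simp add: sum_distrib_left sum_distrib_right mult.assoc sum.swap[of _ "P S"])
  also have "\<dots> \<le> (\<Sum>x\<in>P S. g x * ?b ^ r x)"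
    unfolding sum_pmf_of_bool[OF A(1)] g_def using b
    by (intro sum_mono mult_right_mono measure_pmf.finite_measure_mono) auto
  also have "\<dots> = (\<Sum>x\<in>P S. g x * k ^ r x * (1 / \<alpha>) ^ r x)"
    by (simp add: power_divide)
  also have "\<dots> \<le> (\<Sum>x\<in>P S. t * k ^ j * (1 / \<alpha>) ^ r x)"
  proof (intro sum_mono mult_right_mono)
    fix x assume "x \<in> P S"
    then show "g x * k ^ r x \<le> t * k ^ j"
      using ladder_rank_bound[OF fin(2) A(3) tk lad, of x] unfolding P_def r_def by simp
  qed (use \<alpha> in auto)
  also have "\<dots> = t * k ^ j * (\<Sum>x\<in>P S. (1 / \<alpha>) ^ r x)"
    by (simp add: sum_distrib_left)
  also have "\<dots> \<le> t * k ^ j * (1 / (\<alpha> - 1))"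
  proof (intro mult_left_mono)
    have "(\<Sum>x\<in>P S. (1 / \<alpha>) ^ r x) * (1 - 1 / \<alpha>) \<le> 1 / \<alpha> - (1 / \<alpha>) ^ Suc (card (P S))"
      unfolding r_def using \<alpha> fin by (intro sum_power_rank_le) auto
    also have "\<dots> \<le> 1 / \<alpha>"
      using \<alpha> by simp
    finally have "(\<Sum>x\<in>P S. (1 / \<alpha>) ^ r x) * (1 - 1 / \<alpha>) * \<alpha> \<le> 1 / \<alpha> * \<alpha>"
      using \<alpha> by (intro mult_right_mono) auto
    moreover have "(1 - 1 / \<alpha>) * \<alpha> = \<alpha> - 1"
      using \<alpha> by (simp add: field_simps)
    ultimately show "(\<Sum>x\<in>P S. (1 / \<alpha>) ^ r x) \<le> 1 / (\<alpha> - 1)"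
      using \<alpha> by (simp add: mult.assoc pos_le_divide_eq)
  qed (use tk in auto)
  finally show ?thesis
    by simp
qed

text \<open>Janson's inequality with \<open>\<Delta>\<close> proportional to \<open>M\<close>: the
  exponent \<open>M\<^sup>2 / (2 * \<Delta>)\<close> becomes linear in the mass of \<open>A\<close>,
  as the definition of a robust daisy demands.\<close>

lemma ladder_spread:
  fixes \<mu> :: "'a set pmf" and t k \<alpha> p :: real
  defines "g \<equiv> \<lambda>x. measure_pmf.prob \<mu> {S. x \<in> S}"
  assumes U: "finite U" and tk: "0 < t" "1 \<le> k"
    and A: "A \<subseteq> Pow U" "\<And>S. S \<in> A \<Longrightarrow> ladder (heavy U g t k) j S"
    and p: "1 < \<alpha>" "p = \<alpha> / k" "p \<le> 1"
  shows "1 - exp (- ((\<alpha> - 1) * measure_pmf.prob \<mu> A / (2 * (t * k ^ j))))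
    \<le> measure_pmf.prob (random_subset U p) {W. \<exists>S\<in>A. S - heavy U g t k j \<subseteq> W}"
proof (cases "measure_pmf.prob \<mu> A = 0")
  case True
  \<comment> \<open>Here \<open>\<Delta>\<close> would be 0, which Janson's inequality excludes, but
    the lower bound is 0.\<close>
  then show ?thesis by simp
next
  case False
  let ?K = "heavy U g t k j" and ?R = "random_subset U p"
  define M where "M = measure_pmf.prob \<mu> A"
  define \<Delta> where "\<Delta> = M * (t * k ^ j / (\<alpha> - 1))"
  define P where "P = (\<lambda>S. S - ?K)"
  \<comment> \<open>Dividing by the inclusion probability makes the expected weight of each petal
    equal to its mass under \<open>\<mu>\<close>.\<close>
  define w where "w = (\<lambda>S. pmf \<mu> S / p ^ card (P S))"
  have finA: "finite A"
    using A(1) U by (simp add: finite_subset)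
  have fin: "finite (P S)" if "S \<in> A" for S
    using that A(1) U by (auto simp: P_def intro: finite_subset)
  have p0: "0 < p"
    using p tk by simp
  have \<alpha>k: "\<alpha> \<le> k"
    using p tk by (simp add: divide_le_eq)
  have M: "M = (\<Sum>S\<in>A. pmf \<mu> S)"
    unfolding M_def by (rule measure_measure_pmf_finite[OF finA])
  have M0: "0 < M"
    using False by (simp add: M_def zero_less_measure_iff)
  have "measure_pmf.prob ?R {W. \<forall>S\<in>A. \<not> P S \<subseteq> W} \<le> exp (- (M\<^sup>2 / (2 * \<Delta>)))"
  proof (rule random_subset_janson[where w = w])
    show "M = (\<Sum>S\<in>A. w S * p ^ card (P S))"
      using p0 by (simp add: M w_def)
    show "0 < \<Delta>"
      using M0 tk p by (simp add: \<Delta>_def)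
    have "w S * w T * p ^ card (P S \<union> P T) = pmf \<mu> S * (pmf \<mu> T * (k / \<alpha>) ^ card (P S \<inter> P T))"
      if "S \<in> A" "T \<in> A" for S T
    proof -
      have "p ^ card (P S \<union> P T) * p ^ card (P S \<inter> P T) = p ^ card (P S) * p ^ card (P T)"
        using card_Un_Int[OF fin[OF that(1)] fin[OF that(2)]] by (simp flip: power_add)
      moreover have kp: "k / \<alpha> = 1 / p"
        using p by simp
      ultimately show ?thesis
        unfolding kp using p0 by (simp add: w_def field_simps)
    qed
    then have "(\<Sum>S\<in>A. \<Sum>T | T \<in> A \<and> P S \<inter> P T \<noteq> {}. w S * w T * p ^ card (P S \<union> P T))
       = (\<Sum>S\<in>A. pmf \<mu> S * (\<Sum>T | T \<in> A \<and> P S \<inter> P T \<noteq> {}. pmf \<mu> T * (k / \<alpha>) ^ card (P S \<inter> P T)))"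
      unfolding sum_distrib_left by (intro sum.cong) auto
    also have "\<dots> \<le> (\<Sum>S\<in>A. pmf \<mu> S * (t * k ^ j / (\<alpha> - 1)))"
    proof (intro sum_mono mult_left_mono)
      fix S assume S: "S \<in> A"
      then show "(\<Sum>T | T \<in> A \<and> P S \<inter> P T \<noteq> {}. pmf \<mu> T * (k / \<alpha>) ^ card (P S \<inter> P T)) \<le> t * k ^ j / (\<alpha> - 1)"
        unfolding P_def g_def using A tk p(1) \<alpha>k finA U
        by (intro ladder_correlation_bound) (auto simp: g_def)
    qed auto
    also have "\<dots> = \<Delta>"
      unfolding \<Delta>_def M by (rule sum_distrib_right[symmetric])
    finally show "(\<Sum>S\<in>A. \<Sum>T | T \<in> A \<and> P S \<inter> P T \<noteq> {}. w S * w T * p ^ card (P S \<union> P T)) \<le> \<Delta>" .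
  qed (use U p p0 finA A(1) in \<open>auto simp: w_def P_def\<close>)
  also have "M\<^sup>2 / (2 * \<Delta>) = (\<alpha> - 1) * M / (2 * (t * k ^ j))"
    using M0 p(1) by (simp add: \<Delta>_def power2_eq_square mult_ac)
  also have "{W. \<forall>S\<in>A. \<not> P S \<subseteq> W} = space (measure_pmf ?R) - {W. \<exists>S\<in>A. P S \<subseteq> W}"
    by auto
  finally show ?thesis
    by (subst (asm) measure_pmf.prob_compl) (auto simp: P_def M_def)
qed

subsection \<open>Choice of the level\<close>

lemma sum_degree_eq_expectation_card:
  assumes "finite U" "set_pmf \<mu> \<subseteq> Pow U"
  shows "(\<Sum>x\<in>U. measure_pmf.prob \<mu> {S. x \<in> S}) = measure_pmf.expectation \<mu> (\<lambda>S. real (card S))"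
proof -
  have fin: "finite (set_pmf \<mu>)"
    using assms by (simp add: finite_subset)
  have "measure_pmf.prob \<mu> {S. x \<in> S} = (\<Sum>S\<in>set_pmf \<mu>. pmf \<mu> S * of_bool (x \<in> S))" for x
    unfolding sum_pmf_of_bool[OF fin]
    by (intro measure_pmf.finite_measure_eq_AE) (auto simp: AE_measure_pmf_iff)
  then have "(\<Sum>x\<in>U. measure_pmf.prob \<mu> {S. x \<in> S}) = (\<Sum>S\<in>set_pmf \<mu>. pmf \<mu> S * (\<Sum>x\<in>U. of_bool (x \<in> S)))"
    by (simp add: sum_distrib_left sum.swap[of _ "set_pmf \<mu>"])
  also have "\<dots> = (\<Sum>S\<in>set_pmf \<mu>. real (card S) * pmf \<mu> S)"
  proof (intro sum.cong refl)
    fix S assume "S \<in> set_pmf \<mu>"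
    then have "U \<inter> S = S"
      using assms by auto
    then show "pmf \<mu> S * (\<Sum>x\<in>U. of_bool (x \<in> S)) = real (card S) * pmf \<mu> S"
      using assms(1) by (simp add: of_bool_def sum.If_cases Int_def)
  qed
  also have "\<dots> = measure_pmf.expectation \<mu> (\<lambda>S. real (card S))"
    using fin by (intro integral_measure_pmf_real[symmetric]) auto
  finally show ?thesis .
qed

text \<open>Markov's inequality for the degrees, multiplied out.\<close>

lemma card_heavy_le:
  assumes "finite U" "\<And>x. 0 \<le> g x" "j \<noteq> 0"
  shows "t * k ^ j * real (card (heavy U g t k j)) \<le> (\<Sum>x\<in>U. g x)"
proof -
  have "t * k ^ j * real (card (heavy U g t k j)) = (\<Sum>x\<in>heavy U g t k j. t * k ^ j)"
    by simp
  also have "\<dots> \<le> (\<Sum>x\<in>heavy U g t k j. g x)"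
    using assms(3) by (intro sum_mono) (auto simp: heavy_def)
  also have "\<dots> \<le> (\<Sum>x\<in>U. g x)"
    using assms by (intro sum_mono2) (auto simp: heavy_def)
  finally show ?thesis .
qed

text \<open>Each \<open>S\<close> has at least \<open>c - card S\<close> record levels, so the
  record probabilities of the \<open>c\<close> levels add up to at least \<open>c\<close> minus the
  mean size; some level attains the average.\<close>

lemma exists_good_level:
  fixes \<mu> :: "'a set pmf"
  assumes U: "finite U" "set_pmf \<mu> \<subseteq> Pow U" and K: "antimono K" "K 0 = U" and c: "0 < c"
  shows "\<exists>j\<in>{1..c}. 1 - measure_pmf.expectation \<mu> (\<lambda>S. real (card S)) / real c
    \<le> measure_pmf.prob \<mu> {S \<in> set_pmf \<mu>. ladder K j S}"
proof -
  let ?q = "\<lambda>j. measure_pmf.prob \<mu> {S \<in> set_pmf \<mu>. ladder K j S}"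
  let ?d = "measure_pmf.expectation \<mu> (\<lambda>S. real (card S))"
  have fin: "finite (set_pmf \<mu>)"
    using U by (simp add: finite_subset)
  have d: "?d = (\<Sum>S\<in>set_pmf \<mu>. real (card S) * pmf \<mu> S)"
    using fin by (intro integral_measure_pmf_real) auto
  have "real c - ?d = (\<Sum>S\<in>set_pmf \<mu>. pmf \<mu> S * (real c - real (card S)))"
    using fin by (simp add: d right_diff_distrib sum_subtractf sum_pmf_eq_1 mult.commute flip: sum_distrib_left)
  also have "\<dots> \<le> (\<Sum>S\<in>set_pmf \<mu>. pmf \<mu> S * (\<Sum>j\<in>{1..c}. of_bool (ladder K j S)))"
  proof (intro sum_mono mult_left_mono)
    fix S assume "S \<in> set_pmf \<mu>"
    then have S: "S \<subseteq> U" "finite S"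
      using U by (auto intro: finite_subset)
    have "mono (\<lambda>i. card (S - K i))"
      using S(2) antimonoD[OF K(1)] by (intro monoI card_mono) auto
    moreover have "card (S - K 0) = 0"
      using S(1) K(2) by (simp add: Diff_eq_empty_iff[THEN iffD2])
    ultimately have "c \<le> card (S - K c) + card {j \<in> {1..c}. ladder K j S}"
      unfolding ladder_def by (intro card_strict_records)
    moreover have "card (S - K c) \<le> card S"
      using S(2) by (intro card_mono) auto
    ultimately show "real c - real (card S) \<le> (\<Sum>j\<in>{1..c}. of_bool (ladder K j S))"
      by (simp add: of_bool_def sum.If_cases Int_def)
  qed auto
  also have "\<dots> = (\<Sum>j\<in>{1..c}. ?q j)"
    unfolding sum_pmf_of_bool[OF fin, symmetric] sum_distrib_left by (rule sum.swap)
  finally have sum: "real c - ?d \<le> (\<Sum>j\<in>{1..c}. ?q j)" .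
  show ?thesis
  proof (rule ccontr)
    assume "\<not> ?thesis"
    then have "(\<Sum>j\<in>{1..c}. ?q j) < (\<Sum>j\<in>{1..c}. 1 - ?d / real c)"
      using c by (intro sum_strict_mono) (auto simp: not_le)
    also have "\<dots> = real c - ?d"
      using c by (simp add: field_simps)
    finally show False
      using sum by simp
  qed
qed

section \<open>The conditioned distribution and the assembly of the bounds\<close>

lemma prob_cond_pmf_subset:
  assumes "finite D" "set_pmf \<mu> \<inter> D \<noteq> {}" "A \<subseteq> D"
  shows "measure_pmf.prob (cond_pmf \<mu> D) A = measure_pmf.prob \<mu> A / measure_pmf.prob \<mu> D"
proof -
  have "finite A"
    using assms finite_subset by blast
  then have "measure_pmf.prob (cond_pmf \<mu> D) A = (\<Sum>x\<in>A. pmf (cond_pmf \<mu> D) x)"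
    by (rule measure_measure_pmf_finite)
  also have "\<dots> = (\<Sum>x\<in>A. pmf \<mu> x / measure_pmf.prob \<mu> D)"
    using assms by (intro sum.cong) (auto simp: pmf_cond)
  also have "\<dots> = measure_pmf.prob \<mu> A / measure_pmf.prob \<mu> D"
    using \<open>finite A\<close> by (simp add: measure_measure_pmf_finite sum_divide_distrib)
  finally show ?thesis .
qed

theorem corollary4p6:
  fixes U :: "'a set" and \<mu> :: "'a set pmf" and n q c :: nat and d k :: real
  assumes "finite U" and "card U = n"
    and "set_pmf \<mu> \<subseteq> Pow U"
    and "\<forall>S\<in>set_pmf \<mu>. card S \<le> q"
    and "d = measure_pmf.expectation \<mu> (\<lambda>S. real (card S))" and "d > 0"
    and "real c > d"
    and "k = real n powr (1 / real c)"
  shows "\<exists>\<D> K j B.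
     \<D> \<subseteq> set_pmf \<mu> \<and> K \<subseteq> U \<and> j \<in> {1..c} \<and>
     B = real n / k ^ j \<and> B = real n powr (1 - real j / real c) \<and>
     measure_pmf.prob \<mu> \<D> \<ge> 1 - d / real c \<and>
     real (card K) \<le> B \<and> B \<le> real n powr (1 - 1 / real c) \<and>
     (\<forall>\<alpha> p \<eta>. \<alpha> > 1 \<longrightarrow> p = \<alpha> / k \<longrightarrow> p \<le> 1 \<longrightarrow>
        \<eta> = exp (- ((\<alpha> - 1) * measure_pmf.prob \<mu> \<D> * B / (2 * d))) \<longrightarrow>
          p = \<alpha> * real n powr (- (1 / real c)) \<and>
          robust_daisy U p \<eta> (cond_pmf \<mu> \<D>) K) \<and>
     (q < c \<longrightarrow>
        measure_pmf.prob \<mu> \<D> \<ge> 1 - real q / real c \<and>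
        (\<forall>\<alpha> p \<eta>. \<alpha> > 1 \<longrightarrow> p = \<alpha> / k \<longrightarrow> p \<le> 1 \<longrightarrow>
           \<eta> = exp (- ((\<alpha> - 1) * measure_pmf.prob \<mu> \<D> * B / (2 * d))) \<longrightarrow>
             \<eta> \<le> exp (- ((\<alpha> - 1) * (1 - real q / real c) / (2 * real q) * real (card K)))))"
proof -
  let ?P = "measure_pmf.prob \<mu>"
  define g where "g = (\<lambda>x. ?P {S. x \<in> S})"
  have sumg: "(\<Sum>x\<in>U. g x) = d"
    unfolding g_def assms(5) by (rule sum_degree_eq_expectation_card[OF assms(1,3)])
  have "U \<noteq> {}"
    using sumg \<open>d > 0\<close> by auto
  then have n: "1 \<le> n"
    using assms(1,2) by (simp add: Suc_le_eq card_gt_0_iff flip: assms(2))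
  have c: "0 < c"
    using \<open>d > 0\<close> \<open>real c > d\<close> by simp
  have k: "1 \<le> k"
    unfolding assms(8) using n by (intro ge_one_powr_ge_zero) auto
  have fin: "finite (set_pmf \<mu>)"
    using assms(1,3) by (simp add: finite_subset)
  \<comment> \<open>The average degree. It makes \<open>t * k ^ j\<close> equal to
    \<open>d / B\<close>, which turns Markov's inequality into
    \<open>card (K j) \<le> B\<close>.\<close>
  define t where "t = d / real n"
  have t: "0 < t"
    using n \<open>d > 0\<close> by (simp add: t_def)
  define K where "K = heavy U g t k"
  have "antimono K"
    unfolding K_def using t k by (intro antimonoI heavy_antimono) auto
  moreover have "K 0 = U"
    by (simp add: K_def heavy_def)
  ultimately obtain j where j: "j \<in> {1..c}" "1 - d / real c \<le> ?P {S \<in> set_pmf \<mu>. ladder K j S}"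
    using exists_good_level[OF assms(1,3) _ _ c] unfolding assms(5) by blast
  define D where "D = {S \<in> set_pmf \<mu>. ladder K j S}"
  define B where "B = real n / k ^ j"
  have finD: "finite D"
    using fin by (simp add: D_def)
  \<comment> \<open>Positive mass of \<open>D\<close> is what makes the conditioned distribution
    meaningful.\<close>
  have "0 < 1 - d / real c"
    using \<open>real c > d\<close> c by simp
  then have PD: "0 < ?P D"
    using j(2) unfolding D_def by linarith
  have B0: "0 < B"
    using n k by (simp add: B_def)
  have tB: "t * k ^ j = d / B"
    using n k by (simp add: t_def B_def)
  have "k ^ j = real n powr (real j / real c)"
    unfolding assms(8) using n by (simp add: powr_powr flip: powr_realpow)
  then have Bpowr: "B = real n powr (1 - real j / real c)"
    using n by (simp add: B_def powr_diff)
  have Ble: "B \<le> real n powr (1 - 1 / real c)"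
    unfolding Bpowr using n j(1) c by (intro powr_mono) (auto simp: divide_right_mono)
  have KU: "K j \<subseteq> U"
    by (auto simp: K_def heavy_def)
  have "d / B * real (card (K j)) \<le> d"
    using card_heavy_le[OF assms(1), of g j t k] j(1) sumg unfolding K_def tB by (auto simp: g_def)
  then have cardK: "real (card (K j)) \<le> B"
    using B0 \<open>d > 0\<close> by (simp add: field_simps)
  have ne: "set_pmf \<mu> \<inter> D \<noteq> {}"
  proof
    assume "set_pmf \<mu> \<inter> D = {}"
    then have "D = {}" by (auto simp: D_def)
    then show False using PD by simp
  qed
  have daisy: "robust_daisy U p \<eta> (cond_pmf \<mu> D) (K j)"
    if \<alpha>: "\<alpha> > 1" "p = \<alpha> / k" "p \<le> 1" and \<eta>: "\<eta> = exp (- ((\<alpha> - 1) * ?P D * B / (2 * d)))" for \<alpha> p \<eta>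
  proof -
    have D: "D \<subseteq> Pow U" "set_pmf \<mu> \<inter> D = D"
      using assms(3) by (auto simp: D_def)
    have spread: "1 - \<eta> powr (measure_pmf.prob (cond_pmf \<mu> D) A)
        \<le> measure_pmf.prob (random_subset U p) {W. \<exists>S\<in>A. S - K j \<subseteq> W}" if A: "A \<subseteq> D" for A
    proof -
      \<comment> \<open>Conditioning divides the mass of \<open>A\<close> by that of
        \<open>D\<close>, which cancels the factor \<open>?P D\<close> in the exponent of
        \<open>\<eta>\<close>.\<close>
      have "\<eta> powr (measure_pmf.prob (cond_pmf \<mu> D) A)
          = exp (- ((\<alpha> - 1) * ?P A / (2 * (t * k ^ j))))"
        using PD B0 \<open>d > 0\<close> unfolding prob_cond_pmf_subset[OF finD ne A] \<eta> tB
        by (simp add: powr_def field_simps)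
      moreover have "1 - exp (- ((\<alpha> - 1) * ?P A / (2 * (t * k ^ j))))
          \<le> measure_pmf.prob (random_subset U p) {W. \<exists>S\<in>A. S - K j \<subseteq> W}"
        using ladder_spread[OF assms(1) t k, of A \<mu> j \<alpha> p] A D(1) \<alpha>
        unfolding K_def g_def D_def by auto
      ultimately show ?thesis by simp
    qed
    \<comment> \<open>Strict positivity gives \<open>\<eta> < 1\<close>.\<close>
    have "0 < (\<alpha> - 1) * ?P D * B / (2 * d)"
      using \<alpha> PD B0 \<open>d > 0\<close> by simp
    then show ?thesis
      unfolding robust_daisy_def set_cond_pmf[OF ne] D(2)
      using assms(1) D(1) KU \<alpha> k spread \<eta> by auto
  qed
  have d_le: "d \<le> real q"
  proof -
    have "d \<le> measure_pmf.expectation \<mu> (\<lambda>S. real q)"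
      unfolding assms(5) using fin assms(4)
      by (intro integral_mono_AE) (auto simp: integrable_measure_pmf_finite AE_measure_pmf_iff)
    then show ?thesis by simp
  qed
  have prob_q: "1 - real q / real c \<le> ?P D"
    using j(2) divide_right_mono[OF d_le, of "real c"] unfolding D_def by simp
  have eta_q: "\<eta>
      \<le> exp (- ((\<alpha> - 1) * (1 - real q / real c) / (2 * real q) * real (card (K j))))"
    if "q < c" "\<alpha> > 1" "\<eta> = exp (- ((\<alpha> - 1) * ?P D * B / (2 * d)))" for \<alpha> \<eta>
  proof -
    \<comment> \<open>The exponent shrinks when \<open>?P D\<close> and \<open>B\<close> are
      replaced by their lower bounds and \<open>d\<close> by the larger \<open>q\<close>.\<close>
    have "(\<alpha> - 1) * ((1 - real q / real c) * real (card (K j)) / (2 * real q))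
        \<le> (\<alpha> - 1) * (?P D * B / (2 * d))"
      using that cardK prob_q d_le \<open>d > 0\<close> B0 c
      by (intro mult_left_mono frac_le mult_mono) auto
    then show ?thesis unfolding that(3) by (simp add: mult_ac)
  qed
  have p_eq: "p = \<alpha> * real n powr (- (1 / real c))" if "p = \<alpha> / k" for \<alpha> p
    using that by (simp add: assms(8) powr_minus divide_inverse)
  have "D \<subseteq> set_pmf \<mu>" "1 - d / real c \<le> ?P D"
    using j(2) by (auto simp: D_def)
  note facts = this KU j(1) B_def Bpowr cardK Ble
  show ?thesis
  proof (rule exI[of _ D], rule exI[of _ "K j"], rule exI[of _ j], rule exI[of _ B], intro conjI)
    show "\<forall>\<alpha> p \<eta>. \<alpha> > 1 \<longrightarrow> p = \<alpha> / k \<longrightarrow> p \<le> 1 \<longrightarrow>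
        \<eta> = exp (- ((\<alpha> - 1) * ?P D * B / (2 * d))) \<longrightarrow>
        p = \<alpha> * real n powr (- (1 / real c)) \<and> robust_daisy U p \<eta> (cond_pmf \<mu> D) (K j)"
      using p_eq daisy by blast
    show "q < c \<longrightarrow> 1 - real q / real c \<le> ?P D \<and>
        (\<forall>\<alpha> p \<eta>. \<alpha> > 1 \<longrightarrow> p = \<alpha> / k \<longrightarrow> p \<le> 1 \<longrightarrow>
           \<eta> = exp (- ((\<alpha> - 1) * ?P D * B / (2 * d))) \<longrightarrow>
             \<eta> \<le> exp (- ((\<alpha> - 1) * (1 - real q / real c) / (2 * real q) * real (card (K j)))))"
      using prob_q eta_q by blast
  qed (fact facts)+
qed

end
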